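(* Let $n\ge 2$ and let $\tilde L$ be a standardized Laplacian matrix of order $n$. Then every eigenvalue of $\tilde L$ lies in the intersection of: the two closed disks of radius $1-1/n$ centered at $1/n$ and at $1-1/n$, respectively; the two closed smaller angles, one with vertex $1$ bounded by the two half-lines drawn from $1$ through $e^{-2\pi i/n}$ and $e^{2\pi i/n}$, the other with vertex $0$ bounded by the two half-lines drawn from $0$ through $e^{-(\frac{\pi}{2}-\frac{\pi}{n})i}$ and $e^{(\frac{\pi}{2}-\frac{\pi}{n})i}$; and the band $\{z\in\mathbb{C}: |\operatorname{Im}(z)|\le \frac{1}{2n}\cot\frac{\pi}{2n}\}$.
   Context: A standardized Laplacian matrix of order $n$ is a real matrix $\tilde L=(\ell_{ij})\in\mathbb{R}^{n\times n}$ such that $-\frac1n\le \ell_{ij}\le 0$ for all $j\ne i$ and $\sum_{j=1}^n \ell_{ij}=0$ for every $i$. *)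

theory Defs
  imports "HOL-Analysis.Analysis" "Jordan_Normal_Form.Char_Poly"
begin

definition standardized_laplacian :: "nat \<Rightarrow> real mat \<Rightarrow> bool" where
  "standardized_laplacian n L \<longleftrightarrow>
     L \<in> carrier_mat n n \<and>
     (\<forall>i<n. \<forall>j<n. j \<noteq> i \<longrightarrow> - (1 / real n) \<le> L $$ (i, j) \<and> L $$ (i, j) \<le> 0) \<and>
     (\<forall>i<n. (\<Sum>j<n. L $$ (i, j)) = 0)"

definition half_line :: "complex \<Rightarrow> complex \<Rightarrow> complex set" where
  "half_line v p = {v + complex_of_real t * (p - v) | t. t \<ge> 0}"

text \<open>
  The convex hull of two half-lines from a common vertex \<open>v\<close> is the closed angle of
  measure less than \<open>pi\<close> that they bound; if the half-lines coincide, it is the half-line itself.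
  The definition is not meant for opposite half-lines (measure \<open>pi\<close>), where no angle is the smaller one.
\<close>
definition closed_smaller_angle :: "complex \<Rightarrow> complex \<Rightarrow> complex \<Rightarrow> complex set" where
  "closed_smaller_angle v p q = convex hull (half_line v p \<union> half_line v q)"

end

theory Submission imports Defs "HOL-Library.Real_Mod" begin

text \<open>
  If \<open>z \<noteq> 0\<close> is an eigenvalue of a standardized Laplacian matrix \<open>L\<close>, then \<open>1 - z\<close> is an eigenvalue of
  the standardized Laplacian matrix \<open>I - J/n - L\<close>, where \<open>J\<close> is the all-ones matrix. This exchanges the two
  disks and the two angles, so one of each suffices.

  The disk centred at \<open>1 - 1/n\<close> contains every Gershgorin disk.

  For the angle at 0 (the argument of Dmitriev and Dynkin), let \<open>x\<close> be an eigenvector and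
  \<open>0 < \<theta> < Arg z\<close>. From each nonzero entry \<open>x\<^sub>i\<close> the eigenvalue equation leads to another entry strictly beyond
  the line through \<open>x\<^sub>i\<close> that makes the angle \<open>\<theta>\<close> with the direction to 0, on the side away from 0.
  Following these steps gives a cycle of length \<open>m \<le> n\<close> around 0; comparing moduli along it forces
  \<open>\<theta> < \<pi>/2 - \<pi>/m\<close>.

  The band is Pick's bound: the imaginary part of \<open>z\<close> is a value of the form of the skew part of \<open>L\<close>, whose
  entries are at most \<open>1/(2n)\<close> in modulus. After changing signs and sorting the entries of the eigenvector by
  argument, the worst case is the matrix \<open>sgn (l - j)\<close>, which is explicitly diagonalisable.
\<close>

subsection \<open>The sector\<close>

text \<open>The function \<open>ln \<circ> sin\<close> is concave on \<open>{0<..<pi}\<close>, with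
  second derivative \<open>- inverse ((sin x)\<^sup>2)\<close>.\<close>

lemma ln_sin_le_tangent:
  fixes s t :: real
  assumes "s \<in> {0<..<pi}" "t \<in> {0<..<pi}"
  shows "ln (sin t) \<le> ln (sin s) + cot s * (t - s)"
proof -
  have sin_pos: "sin x > 0" if "x \<in> {0<..<pi}" for x
    using that by (auto intro: sin_gt_zero)
  have conv: "convex_on {0<..<pi} (\<lambda>x. - ln (sin x))"
  proof (rule f''_ge0_imp_convex)
    fix x :: real assume "x \<in> {0<..<pi}"
    then have "sin x > 0" by (rule sin_pos)
    then show "((\<lambda>x. - ln (sin x)) has_real_derivative - cot x) (at x)"
      by (auto intro!: derivative_eq_intros simp: cot_def field_simps)
    show "((\<lambda>x. - cot x) has_real_derivative inverse ((sin x)\<^sup>2)) (at x)"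
      using \<open>sin x > 0\<close> by (auto intro!: derivative_eq_intros DERIV_cot)
    show "inverse ((sin x)\<^sup>2) \<ge> 0" by simp
  qed auto
  have "- ln (sin t) - (- ln (sin s)) \<ge> (- cot s) * (t - s)"
  proof (rule convex_on_imp_above_tangent[OF conv])
    show "connected {0<..<pi}" "t \<in> {0<..<pi}" using assms by simp_all
    show "s \<in> interior {0<..<pi}" using assms by (simp add: interior_open)
    show "((\<lambda>x. - ln (sin x)) has_real_derivative - cot s) (at s within {0<..<pi})"
      using sin_pos[OF assms(1)]
      by (auto intro!: derivative_eq_intros simp: cot_def field_simps)
  qed
  then show ?thesis by simp
qed

text \<open>Jensen's inequality for \<open>ln \<circ> sin\<close>: the tangent bounds at the mean
  are added, and their linear terms cancel.\<close>

lemma prod_sin_le_power_sin_mean: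
  fixes t :: "nat \<Rightarrow> real"
  assumes "m > 0" and t: "\<And>k. k < m \<Longrightarrow> t k \<in> {0<..<pi}"
  shows "(\<Prod>k<m. sin (t k)) \<le> sin ((\<Sum>k<m. t k) / real m) ^ m"
    and "(\<Sum>k<m. t k) / real m \<in> {0<..<pi}"
proof -
  define s where "s = (\<Sum>k<m. t k) / real m"
  have "(\<Sum>k<m. t k) > (\<Sum>k<m. 0)"
    using assms by (intro sum_strict_mono) auto
  moreover have "(\<Sum>k<m. t k) < (\<Sum>k<m. pi)"
    using assms by (intro sum_strict_mono) auto
  ultimately show s: "(\<Sum>k<m. t k) / real m \<in> {0<..<pi}"
    using \<open>m > 0\<close> by (simp add: field_simps)
  have "sin s > 0" using s unfolding s_def by (intro sin_gt_zero) auto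
  have "(\<Sum>k<m. ln (sin (t k))) \<le> (\<Sum>k<m. ln (sin s) + cot s * (t k - s))"
    using t s by (intro sum_mono ln_sin_le_tangent) (auto simp: s_def)
  also have "\<dots> = real m * ln (sin s) + cot s * ((\<Sum>k<m. t k) - real m * s)"
    by (simp add: sum.distrib sum_subtractf flip: sum_distrib_left)
  also have "(\<Sum>k<m. t k) - real m * s = 0"
    using \<open>m > 0\<close> by (simp add: s_def)
  finally have "(\<Sum>k<m. ln (sin (t k))) \<le> ln (sin s ^ m)"
    using \<open>sin s > 0\<close> by (simp add: ln_realpow)
  moreover have "ln (\<Prod>k<m. sin (t k)) = (\<Sum>k<m. ln (sin (t k)))"
    using t sin_gt_zero by (intro ln_prod) (fastforce simp: less_imp_neq)+
  moreover have "(\<Prod>k<m. sin (t k)) > 0"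
    using t by (intro prod_pos) (auto intro!: sin_gt_zero)
  ultimately show "(\<Prod>k<m. sin (t k)) \<le> sin ((\<Sum>k<m. t k) / real m) ^ m"
    using \<open>sin s > 0\<close> by (metis ln_le_cancel_iff s_def zero_less_power)
qed

lemma cis_sum: "cis (\<Sum>k\<in>A. t k) = (\<Prod>k\<in>A. cis (t k))"
  by (induction A rule: infinite_finite_induct) (auto simp flip: cis_mult)

text \<open>
  The factors \<open>w k\<close> are the conjugated quotients \<open>x\<^sub>k\<^sub>+\<^sub>1 / x\<^sub>k\<close> of a closed walk, turned by \<open>\<theta>\<close>.
  The strict inequality excludes winding number 0, so the walk turns by at least \<open>2\<pi>\<close> in total,
  and concavity of \<open>ln \<circ> sin\<close> bounds the mean turn.
\<close>
lemma angle_bound_of_closed_walk: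
  fixes w :: "nat \<Rightarrow> complex"
  assumes "m > 0" "0 < \<theta>" "\<theta> \<le> pi / 2"
    and Im_w: "\<And>k. k < m \<Longrightarrow> Im (w k) > sin \<theta>"
    and prod_w: "(\<Prod>k<m. w k) = cis (real m * \<theta>)"
  shows "\<theta> < pi / 2 - pi / real m"
proof -
  have sin_\<theta>: "sin \<theta> > 0" using assms by (intro sin_gt_zero) auto
  define t where "t k = Arg (w k)" for k
  define s where "s = (\<Sum>k<m. t k) / real m"
  have t: "t k \<in> {0<..<pi}" if "k < m" for k
    using Im_w[OF that] sin_\<theta> Arg_lt_pi[of "w k"] by (auto simp: t_def)
  have w: "w k = cmod (w k) * cis (t k)" for k
    using rcis_cmod_Arg[of "w k"] by (simp add: rcis_def t_def)
  have norm1: "(\<Prod>k<m. cmod (w k)) = 1"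
    using arg_cong[OF prod_w, of cmod] by (simp add: prod_norm)
  have "(\<Prod>k<m. w k) = (\<Prod>k<m. complex_of_real (cmod (w k))) * (\<Prod>k<m. cis (t k))"
    by (subst w) (simp add: prod.distrib)
  also have "(\<Prod>k<m. complex_of_real (cmod (w k))) = 1"
    using norm1 by (simp flip: of_real_prod)
  finally have "cis (\<Sum>k<m. t k) = cis (real m * \<theta>)"
    using prod_w by (simp add: cis_sum)
  then have "cis ((\<Sum>k<m. t k) - real m * \<theta>) = 1"
    by (simp flip: cis_divide)
  \<comment> \<open>The turns \<open>t k - \<theta>\<close> of the single steps add up to
    \<open>2 * pi * K\<close>, so \<open>K\<close> is the winding number.\<close>
  then obtain K where "(\<Sum>k<m. t k) - real m * \<theta> = of_int K * (2 * pi)"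
    unfolding cis_eq_1_iff by blast
  then have s_eq: "s = \<theta> + 2 * pi * of_int K / real m"
    using \<open>m > 0\<close> by (simp add: s_def field_simps)
  \<comment> \<open>The bounds on \<open>Im (w k)\<close> are multiplied; the moduli have product 1,
    so only the sines of the arguments remain.\<close>
  have "sin \<theta> ^ m = (\<Prod>k<m. sin \<theta>)" by simp
  also have "\<dots> < (\<Prod>k<m. Im (w k))"
    using \<open>m > 0\<close> Im_w sin_\<theta>
    by (intro prod_mono_strict) (auto intro: less_imp_le less_trans)
  also have "\<dots> = (\<Prod>k<m. cmod (w k)) * (\<Prod>k<m. sin (t k))"
    by (subst w) (simp add: prod.distrib)
  also have "\<dots> \<le> sin s ^ m"
    using prod_sin_le_power_sin_mean(1)[of m t] t \<open>m > 0\<close> by (simp add: norm1 s_def)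
  finally have "sin \<theta> ^ m < sin s ^ m" .
  moreover have s: "s \<in> {0<..<pi}"
    using prod_sin_le_power_sin_mean(2)[of m t] t \<open>m > 0\<close> by (simp add: s_def)
  ultimately have less: "sin \<theta> < sin s"
    using sin_gt_zero[of s] by (auto intro: power_less_imp_less_base)
  \<comment> \<open>The sine increases up to \<open>pi / 2\<close>, so
    \<open>s \<le> \<theta>\<close> would contradict \<open>less\<close>. This rules out winding
    number 0.\<close>
  have "\<theta> < s"
    using less s \<open>\<theta> \<le> pi / 2\<close> sin_monotone_2pi_le[of s \<theta>] by (cases "s \<le> \<theta>") auto
  then have "of_int K > (0 :: real)"
    using \<open>m > 0\<close> by (simp add: s_eq zero_less_divide_iff zero_less_mult_iff)
  then have "of_int K \<ge> (1 :: real)" by simp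
  then have "2 * pi / real m \<le> s - \<theta>"
    using \<open>m > 0\<close> by (simp add: s_eq divide_right_mono)
  \<comment> \<open>By symmetry of the sine about \<open>pi / 2\<close>. Hence
    \<open>2 * pi / m\<close> is less than the gap \<open>pi - 2 * \<theta>\<close> between
    \<open>\<theta>\<close> and \<open>pi - \<theta>\<close>.\<close>
  moreover have "s < pi - \<theta>"
    using less s \<open>\<theta> \<le> pi / 2\<close> \<open>0 < \<theta>\<close> sin_monotone_2pi_le[of "pi - s" \<theta>]
    by (cases "s < pi - \<theta>") auto
  ultimately show ?thesis by simp
qed

text \<open>Pigeonhole: among the \<open>card S + 1\<close> iterates of \<open>i\<close> with
  exponent at most \<open>card S\<close>, two coincide, and the earlier one lies on a cycle.\<close>

lemma self_map_has_cycle: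
  fixes f :: "'a \<Rightarrow> 'a"
  assumes "finite S" "f ` S \<subseteq> S" "i \<in> S"
  obtains j m where "j \<in> S" "0 < m" "m \<le> card S" "(f ^^ m) j = j"
proof -
  have mem: "(f ^^ k) j \<in> S" if "j \<in> S" for j k
    using that assms(2) by (induction k) auto
  have "\<not> inj_on (\<lambda>k. (f ^^ k) i) {..card S}"
  proof
    assume "inj_on (\<lambda>k. (f ^^ k) i) {..card S}"
    then have "card {..card S} \<le> card S"
      using assms mem by (intro card_inj_on_le[where f = "\<lambda>k. (f ^^ k) i"]) auto
    then show False by simp
  qed
  then obtain p q where "p < q" "q \<le> card S" "(f ^^ p) i = (f ^^ q) i"
    unfolding inj_on_def by (metis atMost_iff linorder_neqE_nat)
  then have "(f ^^ (q - p)) ((f ^^ p) i) = (f ^^ p) i"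
    by (metis add.commute comp_apply funpow_add le_add_diff_inverse less_imp_le)
  then show ?thesis
    using that[of "(f ^^ p) i" "q - p"] mem[OF assms(3)]
      \<open>p < q\<close> \<open>q \<le> card S\<close> by auto
qed

lemma laplacian_eigenvalue_Arg_le:
  fixes a :: "nat \<Rightarrow> nat \<Rightarrow> real" and x :: "nat \<Rightarrow> complex"
  assumes nonpos: "\<And>i j. i < n \<Longrightarrow> j < n \<Longrightarrow> j \<noteq> i \<Longrightarrow> a i j \<le> 0"
    and row_sum: "\<And>i. i < n \<Longrightarrow> (\<Sum>j<n. a i j) = 0"
    and eig: "\<And>i. i < n \<Longrightarrow> (\<Sum>j<n. of_real (a i j) * x j) = z * x i"
    and nz: "\<exists>i<n. x i \<noteq> 0"
    and "Im z > 0" "Re z \<ge> 0"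
  shows "Arg z \<le> pi / 2 - pi / real n"
\<comment> \<open>The walk needs \<open>Im (z * cis (- \<theta>)) > 0\<close>, which fails for
  \<open>\<theta> = Arg z\<close>; so smaller \<open>\<theta>\<close> are treated and density gives
  the bound.\<close>
proof (rule dense_le_bounded[of 0])
  show "0 < Arg z" using \<open>Im z > 0\<close> Arg_lt_pi by blast
  fix \<theta> assume \<theta>: "0 < \<theta>" "\<theta> < Arg z"
  have "Arg z \<le> pi / 2" 
    using \<open>Re z \<ge> 0\<close> Arg_Re_nonneg[of z] by simp
  have Im_z: "Im (z * cis (- \<theta>)) > 0"
  proof -
    have "z * cis (- \<theta>) = cmod z * cis (Arg z - \<theta>)"
      using rcis_cmod_Arg[of z] by (metis cis_mult mult.assoc diff_conv_add_uminus rcis_def)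
    moreover have "cmod z > 0" using \<open>Im z > 0\<close> by auto
    moreover have "sin (Arg z - \<theta>) > 0" 
      using \<theta> \<open>Arg z \<le> pi / 2\<close> by (intro sin_gt_zero) auto
    ultimately show ?thesis by simp
  qed
  define S where "S = {i. i < n \<and> x i \<noteq> 0}"
  \<comment> \<open>The zero row sum turns the eigenvalue equation into
    \<open>z = (\<Sum>j<n. a i j * (x j / x i - 1))\<close>. If no \<open>x j\<close> lay beyond the
    line through \<open>x i\<close>, the nonpositive weights would give
    \<open>Im (z * cis (- \<theta>)) \<le> 0\<close>.\<close>
  have "\<exists>j\<in>S. Im (x j / x i * cis (- \<theta>)) < - sin \<theta>" if "i \<in> S" for i
  proof -
    from that have i: "i < n" "x i \<noteq> 0" by (auto simp: S_def)
    have "\<exists>j<n. Im (x j / x i * cis (- \<theta>)) < - sin \<theta>"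
    proof (rule ccontr)
      assume "\<not> ?thesis"
      then have ge: "Im (x j / x i * cis (- \<theta>)) \<ge> - sin \<theta>" if "j < n" for j
        using that by auto
      have "(\<Sum>j<n. complex_of_real (a i j)) = 0"
        using row_sum[OF i(1)] by (metis of_real_0 of_real_sum)
      then have "z = (\<Sum>j<n. of_real (a i j) * x j) / x i - (\<Sum>j<n. complex_of_real (a i j))"
        using eig[OF i(1)] i(2) by simp
      then have "z = (\<Sum>j<n. of_real (a i j) * (x j / x i - 1))"
        by (simp add: sum_divide_distrib sum_subtractf algebra_simps)
      then have "z * cis (- \<theta>) = (\<Sum>j<n. of_real (a i j) * ((x j / x i - 1) * cis (- \<theta>)))"
        by (simp only: sum_distrib_right mult.assoc)
      then have "Im (z * cis (- \<theta>)) = (\<Sum>j<n. a i j * Im ((x j / x i - 1) * cis (- \<theta>)))"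
        by (simp only: Im_sum Im_complex_of_real Re_complex_of_real times_complex.sel) simp
      also have "\<dots> \<le> 0"
      proof (rule sum_nonpos)
        fix j assume "j \<in> {..<n}"
        then show "a i j * Im ((x j / x i - 1) * cis (- \<theta>)) \<le> 0"
          using nonpos[of i j] i ge[of j]
          by (cases "j = i") (auto intro!: mult_nonpos_nonneg simp: left_diff_distrib)
      qed
      finally show False using Im_z by simp
    qed
    then obtain j where j: "j < n" "Im (x j / x i * cis (- \<theta>)) < - sin \<theta>" by blast
    moreover have "sin \<theta> > 0" using \<theta> \<open>Arg z \<le> pi / 2\<close> by (intro sin_gt_zero) auto
    \<comment> \<open>The value 0 would give imaginary part 0, which is not below
      \<open>- sin \<theta>\<close>; so the walk never enters 0 and can continue.\<close>
    ultimately have "x j \<noteq> 0" by auto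
    with j show ?thesis by (auto simp: S_def)
  qed
  then obtain f where f: "\<And>i. i \<in> S \<Longrightarrow> f i \<in> S"
      "\<And>i. i \<in> S \<Longrightarrow> Im (x (f i) / x i * cis (- \<theta>)) < - sin \<theta>"
    by metis
  have "finite S" "card S \<le> n"
    using card_mono[of "{..<n}" S] by (auto simp: S_def)
  obtain i where "i \<in> S" using nz by (auto simp: S_def)
  have "f ` S \<subseteq> S" using f(1) by auto
  obtain j m where "j \<in> S" and m: "0 < m" "m \<le> card S" "(f ^^ m) j = j"
    by (rule self_map_has_cycle[OF \<open>finite S\<close> \<open>f ` S \<subseteq> S\<close> \<open>i \<in> S\<close>])
  have orbit: "(f ^^ k) j \<in> S" for k
    using \<open>j \<in> S\<close> f(1) by (induction k) auto
  define y where "y k = x ((f ^^ k) j)" for k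
  \<comment> \<open>Conjugation turns the upper bound \<open>- sin \<theta>\<close> into the lower
    bound \<open>sin \<theta>\<close>; around the cycle the quotients of \<open>y\<close> telescope
    to 1.\<close>
  define w where "w k = cnj (y (Suc k) / y k) * cis \<theta>" for k
  have y_nz: "y k \<noteq> 0" for k using orbit[of k] by (auto simp: y_def S_def)
  have "\<theta> < pi / 2 - pi / real m"
  proof (rule angle_bound_of_closed_walk[where w = w])
    fix k
    have "w k = cnj (y (Suc k) / y k * cis (- \<theta>))" by (simp add: w_def cis_cnj)
    then have "Im (w k) = - Im (y (Suc k) / y k * cis (- \<theta>))" by (simp only: cnj.simps)
    then show "Im (w k) > sin \<theta>"
      using f(2)[OF orbit[of k]] by (simp add: y_def)
  next
    have "(\<Prod>k<m. y (Suc k) / y k) = y m / y 0"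
      using y_nz by (intro prod_lessThan_telescope) auto
    also have "y m / y 0 = 1" using y_nz[of 0] m(3) by (simp add: y_def)
    finally have "cnj (\<Prod>k<m. y (Suc k) / y k) = 1" by simp
    then show "(\<Prod>k<m. w k) = cis (real m * \<theta>)"
      by (simp add: w_def prod.distrib Complex.DeMoivre del: complex_cnj_divide)
  qed (use m \<theta> \<open>Arg z \<le> pi / 2\<close> in auto)
  also have "\<dots> \<le> pi / 2 - pi / real n"
    using m \<open>card S \<le> n\<close> by (simp add: frac_le)
  finally show "\<theta> \<le> pi / 2 - pi / real n" by simp
qed

subsection \<open>The band\<close>

lemma cis_odd_multiple_pi: "cis (pi * (2 * real k + 1)) = - 1"
proof -
  have "pi * (2 * real k + 1) = pi + 2 * pi * of_int (int k)" by (simp add: algebra_simps)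
  then show ?thesis by (metis Ints_of_int cis_mult cis_multiple_2pi cis_pi mult.right_neutral)
qed

text \<open>These are power sums of the n-th roots of -1. The geometric sum vanishes unless
  \<open>n\<close> divides \<open>d\<close>. The range of \<open>d\<close> covers all
  \<open>p + (j - l)\<close> with \<open>1 \<le> p < n\<close> and \<open>j, l < n\<close>, as
  needed for the kernel below.\<close>

lemma sum_cis_odd_multiples:
  fixes d :: int
  assumes "n > 0" "- int n < d" "d < 2 * int n"
  shows "(\<Sum>k<n. cis (of_int d * (pi * (2 * real k + 1) / real n))) =
           (if d = 0 then of_nat n else if d = int n then - of_nat n else 0)"
proof -
  define q where "q = cis (2 * pi * of_int d / real n)"
  have "d = 0 \<or> d = int n" if "int n dvd d"
  proof -
    from that obtain c where c: "d = int n * c" by (auto simp: dvd_def)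
    then have "int n * (- 1) < int n * c" "int n * c < int n * 2"
      using assms by linarith+
    moreover have "int n > 0" using \<open>n > 0\<close> by simp
    ultimately have "- 1 < c" "c < 2"
      by (metis mult_less_cancel_left_pos)+
    then have "c = 0 \<or> c = 1" by auto
    then show ?thesis using c by auto
  qed
  then consider "d = 0" | "d = int n" | "\<not> int n dvd d" by blast
  then show ?thesis
  proof cases
    case 2
    have "cis (pi * (2 * real k + 1)) = - 1" for k
      by (rule cis_odd_multiple_pi)
    with 2 show ?thesis using \<open>n > 0\<close> by (simp add: mult.commute)
  next
    case 3
    have "q \<noteq> 1"
    proof
      assume "q = 1"
      then obtain j :: int where "2 * pi * of_int d / real n = of_int j * (2 * pi)"
        unfolding q_def cis_eq_1_iff by blast
      then have "real_of_int d = of_int (int n * j)"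
        using \<open>n > 0\<close> by (simp add: field_simps)
      then show False using 3 by (metis dvd_triv_left of_int_eq_iff)
    qed
    have "q ^ n = cis (2 * pi * of_int d)"
      using \<open>n > 0\<close> by (simp add: q_def Complex.DeMoivre)
    then have "q ^ n = 1" by (metis cis_multiple_2pi Ints_of_int)
    have "(\<Sum>k<n. cis (of_int d * (pi * (2 * real k + 1) / real n))) =
            (\<Sum>k<n. cis (pi * of_int d / real n) * q ^ k)"
      unfolding q_def Complex.DeMoivre cis_mult
      using \<open>n > 0\<close> by (intro sum.cong refl arg_cong[where f = cis]) (simp add: field_simps)
    also have "\<dots> = 0"
      using \<open>q \<noteq> 1\<close> \<open>q ^ n = 1\<close> by (simp add: geometric_sum flip: sum_distrib_left)
    finally show ?thesis using 3 by auto
  qed simp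
qed

lemma odd_half_angle_bounds:
  assumes "k < n"
  shows "0 < pi * (2 * real k + 1) / real n / 2" "pi * (2 * real k + 1) / real n / 2 < pi"
    "pi / (2 * real n) \<le> pi * (2 * real k + 1) / real n / 2"
proof -
  have "pi * (2 * real k + 1) < pi * (2 * real n)"
    using \<open>k < n\<close> by (intro mult_strict_left_mono) auto
  moreover have "pi * (2 * real k + 1) \<ge> pi * 1"
    by (intro mult_left_mono) auto
  moreover have "pi > 0" "real n > 0" using \<open>k < n\<close> by auto
  ultimately show "0 < pi * (2 * real k + 1) / real n / 2" "pi * (2 * real k + 1) / real n / 2 < pi"
    "pi / (2 * real n) \<le> pi * (2 * real k + 1) / real n / 2"
    by (simp_all add: divide_simps)
qed

text \<open>For \<open>q = cis \<alpha>\<close> one has \<open>q ^ n = - 1\<close>, so the geometric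
  sum is \<open>(1 + q) / (1 - q)\<close>, which is purely imaginary. These are the eigenvalues of
  the matrix with entries \<open>sgn (l - j)\<close>.\<close>

lemma sum_cis_multiples_eq_cot:
  assumes "n > 0" "k < n"
  defines "\<alpha> \<equiv> pi * (2 * real k + 1) / real n"
  shows "(\<Sum>p = 1..<n. cis (real p * \<alpha>)) = \<i> * of_real (cot (\<alpha> / 2))"
proof -
  define q where "q = cis \<alpha>"
  define b where "b = \<alpha> / 2"
  have "0 < b" "b < pi"
    using odd_half_angle_bounds[OF \<open>k < n\<close>] by (simp_all only: b_def \<alpha>_def)
  then have "sin b > 0" by (rule sin_gt_zero)
  have \<alpha>: "\<alpha> = 2 * b" by (simp add: b_def)
  have "q \<noteq> 1"
    using \<open>sin b > 0\<close> by (auto simp: q_def \<alpha> complex_eq_iff cos_double_sin)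
  have "q ^ n = cis (pi * (2 * real k + 1))"
    using \<open>n > 0\<close> by (simp add: q_def \<alpha>_def Complex.DeMoivre)
  also have "\<dots> = - 1"
    by (rule cis_odd_multiple_pi)
  finally have "q ^ n = - 1" .
  have "(\<Sum>p = 1..<n. cis (real p * \<alpha>)) = (\<Sum>p<n. q ^ p) - 1"
    using \<open>n > 0\<close> by (simp add: q_def Complex.DeMoivre lessThan_atLeast0 sum.atLeast_Suc_lessThan)
  also have "\<dots> = (1 + q) / (1 - q)"
    using \<open>q \<noteq> 1\<close> \<open>q ^ n = - 1\<close> by (simp add: geometric_sum field_simps)
  also have "\<dots> = \<i> * of_real (cot b)"
  proof -
    have "1 + q = \<i> * of_real (cot b) * (1 - q)"
    proof -
      have "1 + cos \<alpha> = cot b * sin \<alpha>" "sin \<alpha> = cot b * (1 - cos \<alpha>)"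
        using \<open>sin b > 0\<close> unfolding \<alpha> cot_def
        by (simp add: cos_double_cos sin_double power2_eq_square,
            simp add: cos_double_sin sin_double power2_eq_square)
      then show ?thesis by (simp add: q_def complex_eq_iff)
    qed
    then show ?thesis using \<open>q \<noteq> 1\<close> by (simp add: field_simps)
  qed
  finally show ?thesis by (simp add: b_def)
qed

text \<open>The difference \<open>cot a - cot b\<close> equals
  \<open>sin (b - a) / (sin a * sin b)\<close>.\<close>

lemma cot_antimono:
  fixes a b :: real
  assumes "0 < a" "a \<le> b" "b < pi"
  shows "cot b \<le> cot a"
proof -
  have "sin a > 0" "sin b > 0" using assms by (auto intro: sin_gt_zero)
  moreover have "sin (b - a) \<ge> 0" using assms by (intro sin_ge_zero) auto
  ultimately show ?thesis by (simp add: cot_def sin_diff field_simps)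
qed

text \<open>
  The matrix with entries \<open>sgn (l - j)\<close> is diagonalised by the vectors \<open>(\<omega>\<^sup>j)\<^sub>j\<close> with \<open>\<omega>\<^sup>n = -1\<close>,
  because it is the sum of the first \<open>n - 1\<close> powers of the cyclic shift with one sign change.
\<close>
lemma sgn_form_le:
  fixes x :: "nat \<Rightarrow> complex"
  assumes "n > 0"
  shows "(\<Sum>j<n. \<Sum>l<n. of_int (sgn (int l - int j)) * Im (cnj (x j) * x l))
           \<le> cot (pi / (2 * real n)) * (\<Sum>j<n. (cmod (x j))\<^sup>2)"
proof -
  define \<alpha> where "\<alpha> k = pi * (2 * real k + 1) / real n" for k
  \<comment> \<open>Unnormalised coefficients of \<open>x\<close> in the eigenbasis of the sign
    matrix.\<close>
  define C where "C k = (\<Sum>l<n. x l * cis (- (real l * \<alpha> k)))" for k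
  have C: "of_real ((cmod (C k))\<^sup>2) =
      (\<Sum>j<n. \<Sum>l<n. cnj (x j) * x l * cis (of_int (int j - int l) * \<alpha> k))" for k
  proof -
    have "of_real ((cmod (C k))\<^sup>2) = cnj (C k) * C k"
      by (simp add: complex_norm_square mult.commute del: of_real_power)
    also have "\<dots> = (\<Sum>j<n. \<Sum>l<n. cnj (x j) * x l * (cis (real j * \<alpha> k) * cis (- (real l * \<alpha> k))))"
      unfolding C_def cnj_sum sum_product by (simp add: cis_cnj mult_ac)
    finally show ?thesis by (simp add: cis_mult left_diff_distrib)
  qed
  \<comment> \<open>Used twice: weight 1 gives Parseval's identity, and the eigenvalues as weights
    give the sign form.\<close>
  have weighted: "(\<Sum>k<n. g k * of_real ((cmod (C k))\<^sup>2)) =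
      (\<Sum>j<n. \<Sum>l<n. cnj (x j) * x l * (\<Sum>k<n. g k * cis (of_int (int j - int l) * \<alpha> k)))"
    for g :: "nat \<Rightarrow> complex"
  proof -
    have "(\<Sum>k<n. g k * of_real ((cmod (C k))\<^sup>2)) =
      (\<Sum>k<n. \<Sum>j<n. \<Sum>l<n. cnj (x j) * x l * (g k * cis (of_int (int j - int l) * \<alpha> k)))"
      by (simp only: C sum_distrib_left mult_ac)
    also have "\<dots> = (\<Sum>j<n. \<Sum>k<n. \<Sum>l<n. cnj (x j) * x l * (g k * cis (of_int (int j - int l) * \<alpha> k)))"
      by (rule sum.swap)
    also have "\<dots> = (\<Sum>j<n. \<Sum>l<n. \<Sum>k<n. cnj (x j) * x l * (g k * cis (of_int (int j - int l) * \<alpha> k)))"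
      by (intro sum.cong refl sum.swap)
    finally show ?thesis by (simp only: sum_distrib_left)
  qed
  have parseval: "(\<Sum>k<n. (cmod (C k))\<^sup>2) = real n * (\<Sum>j<n. (cmod (x j))\<^sup>2)"
  proof -
    have "(\<Sum>k<n. cis (of_int (int j - int l) * \<alpha> k)) = (if j = l then of_nat n else 0)"
      if "j < n" "l < n" for j l
      using sum_cis_odd_multiples[of n "int j - int l"] that by (auto simp: \<alpha>_def)
    then have "(\<Sum>k<n. of_real ((cmod (C k))\<^sup>2)) =
        (\<Sum>j<n. \<Sum>l<n. cnj (x j) * x l * (if j = l then of_nat n else 0))"
      using weighted[of "\<lambda>_. 1"] by simp
    also have "\<dots> = (\<Sum>j<n. of_nat n * of_real ((cmod (x j))\<^sup>2))"
      by (intro sum.cong refl) (simp add: if_distrib[of "(*) _"] complex_norm_square mult_ac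
        del: of_real_power cong: if_cong)
    finally have "complex_of_real (\<Sum>k<n. (cmod (C k))\<^sup>2) = of_real (real n * (\<Sum>j<n. (cmod (x j))\<^sup>2))"
      by (simp add: sum_distrib_left)
    then show ?thesis by (simp only: of_real_eq_iff)
  qed
  have kernel: "(\<Sum>k<n. \<i> * of_real (cot (\<alpha> k / 2)) * cis (of_int (int j - int l) * \<alpha> k)) =
      of_nat n * of_int (sgn (int l - int j))" if "j < n" "l < n" for j l
  proof -
    have "(\<Sum>k<n. \<i> * of_real (cot (\<alpha> k / 2)) * cis (of_int (int j - int l) * \<alpha> k)) =
        (\<Sum>k<n. \<Sum>p = 1..<n. cis (of_int (int p + (int j - int l)) * \<alpha> k))"
    proof (intro sum.cong refl)
      fix k assume "k \<in> {..<n}"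
      then have "\<i> * of_real (cot (\<alpha> k / 2)) = (\<Sum>p = 1..<n. cis (real p * \<alpha> k))"
        using sum_cis_multiples_eq_cot[of n k] \<open>n > 0\<close> by (simp add: \<alpha>_def)
      then show "\<i> * of_real (cot (\<alpha> k / 2)) * cis (of_int (int j - int l) * \<alpha> k) =
          (\<Sum>p = 1..<n. cis (of_int (int p + (int j - int l)) * \<alpha> k))"
        by (simp add: sum_distrib_right cis_mult distrib_right)
    qed
    also have "\<dots> = (\<Sum>p = 1..<n. \<Sum>k<n. cis (of_int (int p + (int j - int l)) * \<alpha> k))"
      by (rule sum.swap)
    also have "\<dots> = (\<Sum>p = 1..<n. if int p + (int j - int l) = 0 then of_nat n
        else if int p + (int j - int l) = int n then - of_nat n else 0)"
      unfolding \<alpha>_def using that by (intro sum.cong refl sum_cis_odd_multiples) auto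
    also have "\<dots> = of_nat n * of_int (sgn (int l - int j))"
    proof (cases j l rule: linorder_cases)
      case less
      then have "(\<Sum>p = 1..<n. if int p + (int j - int l) = 0 then of_nat n
          else if int p + (int j - int l) = int n then - of_nat n else 0) =
          (\<Sum>p = 1..<n. if p = l - j then of_nat n else (0 :: complex))"
        using that by (intro sum.cong) auto
      also have "\<dots> = of_nat n"
        using less that sum.delta[of "{1..<n}" "l - j" "\<lambda>_. of_nat n :: complex"] by auto
      finally show ?thesis using less by simp
    next
      case equal
      then show ?thesis by (intro sum.neutral[THEN trans]) auto
    next
      \<comment> \<open>The index \<open>p = l - j\<close> is negative here; instead the wrapped
        shift by \<open>n - (j - l)\<close> contributes, with its sign change.\<close>
      case greater
      then have "(\<Sum>p = 1..<n. if int p + (int j - int l) = 0 then of_nat n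
          else if int p + (int j - int l) = int n then - of_nat n else 0) =
          (\<Sum>p = 1..<n. if p = n - (j - l) then - of_nat n else (0 :: complex))"
        using that by (intro sum.cong) auto
      also have "\<dots> = - of_nat n"
        using greater that sum.delta[of "{1..<n}" "n - (j - l)" "\<lambda>_. - of_nat n :: complex"] by auto
      finally show ?thesis using greater by simp
    qed
    finally show ?thesis .
  qed
  have "(\<Sum>k<n. \<i> * of_real (cot (\<alpha> k / 2)) * of_real ((cmod (C k))\<^sup>2)) =
      (\<Sum>j<n. \<Sum>l<n. cnj (x j) * x l * (of_nat n * of_int (sgn (int l - int j))))"
    unfolding weighted by (intro sum.cong refl arg_cong2[where f = "(*)"] kernel) auto
  from arg_cong[OF this, of Im]
  have form: "(\<Sum>k<n. cot (\<alpha> k / 2) * (cmod (C k))\<^sup>2) =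
      real n * (\<Sum>j<n. \<Sum>l<n. of_int (sgn (int l - int j)) * Im (cnj (x j) * x l))"
    by (simp add: sum_distrib_left algebra_simps)
  \<comment> \<open>The half-angles lie in \<open>[pi / (2 * n), pi)\<close>, so the largest
    eigenvalue weight is the one at \<open>k = 0\<close>.\<close>
  have "(\<Sum>k<n. cot (\<alpha> k / 2) * (cmod (C k))\<^sup>2)
      \<le> (\<Sum>k<n. cot (pi / (2 * real n)) * (cmod (C k))\<^sup>2)"
    using \<open>n > 0\<close> odd_half_angle_bounds[of _ n]
    by (intro sum_mono mult_right_mono cot_antimono) (auto simp: \<alpha>_def)
  also have "\<dots> = cot (pi / (2 * real n)) * (\<Sum>k<n. (cmod (C k))\<^sup>2)"
    by (simp add: sum_distrib_left)
  finally show ?thesis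
    using \<open>n > 0\<close> unfolding form parseval by (simp add: field_simps)
qed

text \<open>Replacing \<open>x j\<close> by its negative changes no absolute value, so all entries
  may be moved to the closed upper half-plane. Once they are sorted by argument, argument
  differences for \<open>j \<le> l\<close> lie in \<open>[0, pi]\<close>, and the absolute values
  become the signs \<open>sgn (l - j)\<close>.\<close>

lemma sum_abs_Im_le:
  fixes x :: "nat \<Rightarrow> complex"
  assumes "n > 0"
  shows "(\<Sum>j<n. \<Sum>l<n. \<bar>Im (cnj (x j) * x l)\<bar>)
           \<le> cot (pi / (2 * real n)) * (\<Sum>j<n. (cmod (x j))\<^sup>2)"
proof -
  define y where "y j = (if Im (x j) \<ge> 0 then x j else - x j)" for j
  define ps where "ps = sort_key (\<lambda>j. Arg (y j)) [0..<n]"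
  define p where "p = nth ps"
  have bij: "bij_betw p {..<n} {..<n}"
    unfolding p_def by (rule bij_betw_nth) (auto simp: ps_def)
  have sorted: "Arg (y (p j)) \<le> Arg (y (p l))" if "j \<le> l" "l < n" for j l
    using that sorted_nth_mono[of "map (\<lambda>j. Arg (y j)) ps" j l] by (simp add: ps_def p_def)
  have Arg_y: "0 \<le> Arg (y j)" "Arg (y j) \<le> pi" for j
    using Arg_bounded[of "y j"] Arg_less_0[of "y j"] by (auto simp: y_def not_less)
  have Im_y: "Im (cnj (y j) * y l) = cmod (y j) * cmod (y l) * sin (Arg (y l) - Arg (y j))" for j l
  proof -
    have "cnj (y j) * y l = cnj (rcis (cmod (y j)) (Arg (y j))) * rcis (cmod (y l)) (Arg (y l))"
      by (simp only: rcis_cmod_Arg)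
    also have "\<dots> = of_real (cmod (y j) * cmod (y l)) * cis (Arg (y l) - Arg (y j))"
      by (simp add: rcis_def cis_cnj diff_conv_add_uminus cis_mult[symmetric] del: add_uminus_conv_diff)
    finally show ?thesis by simp
  qed
  have nonneg: "Im (cnj (y (p j)) * y (p l)) \<ge> 0" if "j \<le> l" "l < n" for j l
    unfolding Im_y using sorted[OF that] Arg_y[of "p j"] Arg_y[of "p l"]
    by (intro mult_nonneg_nonneg sin_ge_zero) auto
  have swap: "Im (cnj u * v) = - Im (cnj v * u)" for u v by simp
  have abs_eq: "\<bar>Im (cnj (y (p j)) * y (p l))\<bar> =
      of_int (sgn (int l - int j)) * Im (cnj (y (p j)) * y (p l))" if "j < n" "l < n" for j l
  proof (cases j l rule: linorder_cases)
    case less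
    then show ?thesis using nonneg[of j l] that by simp
  next
    case equal
    then show ?thesis by simp
  next
    case greater
    then have "sgn (int l - int j) = - 1" by simp
    moreover have "Im (cnj (y (p j)) * y (p l)) \<le> 0"
      using nonneg[of l j] greater that swap[of "y (p l)" "y (p j)"] by linarith
    ultimately show ?thesis by (simp only: abs_of_nonpos of_int_minus of_int_1 mult_minus1)
  qed
  have "(\<Sum>j<n. \<Sum>l<n. \<bar>Im (cnj (x j) * x l)\<bar>) = (\<Sum>j<n. \<Sum>l<n. \<bar>Im (cnj (y j) * y l)\<bar>)"
    by (intro sum.cong refl) (auto simp: y_def)
  also have "\<dots> = (\<Sum>j<n. \<Sum>l<n. \<bar>Im (cnj (y (p j)) * y (p l))\<bar>)"
    by (simp only: sum.reindex_bij_betw[OF bij, of "\<lambda>l. \<bar>Im (cnj (y _) * y l)\<bar>"]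
          sum.reindex_bij_betw[OF bij, of "\<lambda>j. \<Sum>l<n. \<bar>Im (cnj (y j) * y l)\<bar>"])
  also have "\<dots> = (\<Sum>j<n. \<Sum>l<n. of_int (sgn (int l - int j)) * Im (cnj (y (p j)) * y (p l)))"
    by (intro sum.cong refl abs_eq) auto
  also have "\<dots> \<le> cot (pi / (2 * real n)) * (\<Sum>j<n. (cmod (y (p j)))\<^sup>2)"
    by (rule sgn_form_le[OF assms])
  also have "(\<Sum>j<n. (cmod (y (p j)))\<^sup>2) = (\<Sum>j<n. (cmod (y j))\<^sup>2)"
    by (rule sum.reindex_bij_betw[OF bij])
  also have "\<dots> = (\<Sum>j<n. (cmod (x j))\<^sup>2)"
    by (intro sum.cong refl) (simp add: y_def)
  finally show ?thesis .
qed

text \<open>The matrix is real and \<open>M\<close> is antisymmetric, so the imaginary part of the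
  form at an eigenvector sees only the differences \<open>a i j - a j i\<close>.\<close>

lemma abs_Im_eigenvalue_le:
  fixes a :: "nat \<Rightarrow> nat \<Rightarrow> real" and x :: "nat \<Rightarrow> complex"
  assumes skew: "\<And>i j. i < n \<Longrightarrow> j < n \<Longrightarrow> \<bar>a i j - a j i\<bar> \<le> 2 * g"
    and eig: "\<And>i. i < n \<Longrightarrow> (\<Sum>j<n. of_real (a i j) * x j) = z * x i"
    and nz: "\<exists>i<n. x i \<noteq> 0"
  shows "\<bar>Im z\<bar> \<le> g * cot (pi / (2 * real n))"
proof -
  define N where "N = (\<Sum>j<n. (cmod (x j))\<^sup>2)"
  define M where "M i j = Im (cnj (x i) * x j)" for i j
  obtain i where i: "i < n" "x i \<noteq> 0" using nz by blast
  then have "n > 0" by simp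
  have "N > 0" unfolding N_def using i by (intro sum_pos2[of _ i]) auto
  have "g \<ge> 0" using skew[OF i(1) i(1)] by simp
  have "z * of_real N = (\<Sum>i<n. cnj (x i) * (z * x i))"
    by (simp add: N_def sum_distrib_left complex_norm_square mult_ac del: of_real_power)
  also have "\<dots> = (\<Sum>i<n. cnj (x i) * (\<Sum>j<n. of_real (a i j) * x j))"
    using eig by simp
  also have "\<dots> = (\<Sum>i<n. \<Sum>j<n. of_real (a i j) * (cnj (x i) * x j))"
    by (simp add: sum_distrib_left mult_ac)
  finally have "Im (z * of_real N) = Im (\<Sum>i<n. \<Sum>j<n. of_real (a i j) * (cnj (x i) * x j))"
    by (rule arg_cong)
  then have form: "Im z * N = (\<Sum>i<n. \<Sum>j<n. a i j * M i j)"
    by (simp add: M_def)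
  also have "\<dots> = (\<Sum>i<n. \<Sum>j<n. a j i * M j i)"
    by (rule sum.swap)
  also have "\<dots> = (\<Sum>i<n. \<Sum>j<n. - a j i * M i j)"
    by (intro sum.cong refl) (simp add: M_def algebra_simps)
  finally have form': "Im z * N = (\<Sum>i<n. \<Sum>j<n. - a j i * M i j)" .
  \<comment> \<open>Adding the form and its copy with exchanged indices isolates the skew
    part.\<close>
  have "2 * (Im z * N) = (\<Sum>i<n. \<Sum>j<n. a i j * M i j) + (\<Sum>i<n. \<Sum>j<n. - a j i * M i j)"
    by (simp only: form[symmetric] form'[symmetric])
  also have "\<dots> = (\<Sum>i<n. \<Sum>j<n. (a i j - a j i) * M i j)"
    by (simp add: algebra_simps flip: sum.distrib)
  finally have skew_form: "2 * (Im z * N) = (\<Sum>i<n. \<Sum>j<n. (a i j - a j i) * M i j)" .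
  have "2 * \<bar>Im z\<bar> * N = \<bar>2 * (Im z * N)\<bar>"
    using \<open>N > 0\<close> by (simp add: abs_mult)
  also have "\<dots> = \<bar>\<Sum>i<n. \<Sum>j<n. (a i j - a j i) * M i j\<bar>"
    by (simp only: skew_form)
  also have "\<dots> \<le> (\<Sum>i<n. \<Sum>j<n. \<bar>(a i j - a j i) * M i j\<bar>)"
    by (intro order_trans[OF sum_abs] sum_mono sum_abs)
  also have "\<dots> \<le> (\<Sum>i<n. \<Sum>j<n. 2 * g * \<bar>M i j\<bar>)"
    unfolding abs_mult using skew by (intro sum_mono mult_right_mono) auto
  also have "\<dots> = 2 * g * (\<Sum>i<n. \<Sum>j<n. \<bar>M i j\<bar>)"
    by (simp add: sum_distrib_left)
  also have "\<dots> \<le> 2 * g * (cot (pi / (2 * real n)) * N)"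
    unfolding M_def N_def using \<open>g \<ge> 0\<close> sum_abs_Im_le[OF \<open>n > 0\<close>, of x]
    by (intro mult_left_mono) auto
  finally have "\<bar>Im z\<bar> * N \<le> g * cot (pi / (2 * real n)) * N" by simp
  then show ?thesis using \<open>N > 0\<close> by simp
qed

subsection \<open>Disks and complement\<close>

text \<open>Gershgorin's argument in the row of an entry of maximal modulus. By the zero row sum the
  radius equals the centre, so the disk touches the imaginary axis at 0.\<close>

lemma gershgorin_laplacian:
  fixes a :: "nat \<Rightarrow> nat \<Rightarrow> real" and x :: "nat \<Rightarrow> complex"
  assumes nonpos: "\<And>i j. i < n \<Longrightarrow> j < n \<Longrightarrow> j \<noteq> i \<Longrightarrow> a i j \<le> 0"
    and row_sum: "\<And>i. i < n \<Longrightarrow> (\<Sum>j<n. a i j) = 0"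
    and eig: "\<And>i. i < n \<Longrightarrow> (\<Sum>j<n. of_real (a i j) * x j) = z * x i"
    and nz: "\<exists>i<n. x i \<noteq> 0"
  shows "\<exists>i<n. cmod (z - of_real (a i i)) \<le> a i i"
proof -
  obtain k where k: "k < n" "x k \<noteq> 0" using nz by blast
  have "Max ((\<lambda>j. cmod (x j)) ` {..<n}) \<in> (\<lambda>j. cmod (x j)) ` {..<n}"
    using k(1) by (intro Max_in) auto
  then obtain i where "i < n" and i_max: "cmod (x i) = Max ((\<lambda>j. cmod (x j)) ` {..<n})"
    by auto
  then have i: "i < n" "\<And>j. j < n \<Longrightarrow> cmod (x j) \<le> cmod (x i)"
    by (auto intro!: Max_ge)
  have "cmod (x i) > 0" using i(2)[OF k(1)] k(2) by (meson less_le_trans zero_less_norm_iff)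
  have diag: "a i i = (\<Sum>j\<in>{..<n} - {i}. - a i j)"
    using row_sum[OF i(1)] i(1) by (simp add: sum.remove[of _ i] sum_negf)
  have "(z - of_real (a i i)) * x i = (\<Sum>j\<in>{..<n} - {i}. of_real (a i j) * x j)"
    using eig[OF i(1)] i(1) by (simp add: sum.remove[of _ i] algebra_simps)
  then have "cmod (z - of_real (a i i)) * cmod (x i) = cmod (\<Sum>j\<in>{..<n} - {i}. of_real (a i j) * x j)"
    by (metis norm_mult)
  also have "\<dots> \<le> (\<Sum>j\<in>{..<n} - {i}. cmod (of_real (a i j) * x j))"
    by (rule norm_sum)
  also have "\<dots> \<le> (\<Sum>j\<in>{..<n} - {i}. - a i j * cmod (x i))"
    using i nonpos[OF i(1)]
    by (intro sum_mono) (auto simp: norm_mult abs_of_nonpos intro!: mult_left_mono_neg)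
  also have "\<dots> = a i i * cmod (x i)"
    by (subst diag) (simp add: sum_distrib_right)
  finally show ?thesis using i(1) \<open>cmod (x i) > 0\<close> by auto
qed

lemma standardized_laplacian_diag_le:
  assumes "standardized_laplacian n L" "i < n"
  shows "L $$ (i, i) \<le> 1 - 1 / real n"
proof -
  have "L $$ (i, i) = (\<Sum>j\<in>{..<n} - {i}. - L $$ (i, j))"
  proof -
    have "0 = (\<Sum>j<n. L $$ (i, j))" using assms by (simp add: standardized_laplacian_def)
    also have "\<dots> = L $$ (i, i) + (\<Sum>j\<in>{..<n} - {i}. L $$ (i, j))"
      using assms(2) by (intro sum.remove) auto
    finally show ?thesis by (simp add: sum_negf)
  qed
  also have "\<dots> \<le> (\<Sum>j\<in>{..<n} - {i}. 1 / real n)"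
    using assms by (intro sum_mono) (force simp: standardized_laplacian_def)
  also have "\<dots> = 1 - 1 / real n"
    using assms(2) by (simp add: card_Diff_singleton field_simps)
  finally show ?thesis .
qed

section \<open>Eigenvalues in coordinates and the complementary Laplacian\<close>

lemma eigenvalue_iff_fun:
  assumes "A \<in> carrier_mat n n"
  shows "eigenvalue A z \<longleftrightarrow>
    (\<exists>x. (\<exists>i<n. x i \<noteq> 0) \<and> (\<forall>i<n. (\<Sum>j<n. A $$ (i, j) * x j) = z * x i))"
proof
  assume "eigenvalue A z"
  then obtain v where v: "v \<in> carrier_vec n" "v \<noteq> 0\<^sub>v n" "A *\<^sub>v v = z \<cdot>\<^sub>v v"
    using assms by (auto simp: eigenvalue_def eigenvector_def)
  have "\<exists>i<n. vec_index v i \<noteq> 0" using v(1,2) by auto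
  moreover have "(\<Sum>j<n. A $$ (i, j) * vec_index v j) = z * vec_index v i" if "i < n" for i
  proof -
    have "vec_index (A *\<^sub>v v) i = (\<Sum>j<n. A $$ (i, j) * vec_index v j)"
      using assms v(1) that by (auto simp: scalar_prod_def atLeast0LessThan)
    then show ?thesis using v that by simp
  qed
  ultimately show "\<exists>x. (\<exists>i<n. x i \<noteq> 0) \<and> (\<forall>i<n. (\<Sum>j<n. A $$ (i, j) * x j) = z * x i)"
    by blast
next
  assume "\<exists>x. (\<exists>i<n. x i \<noteq> 0) \<and> (\<forall>i<n. (\<Sum>j<n. A $$ (i, j) * x j) = z * x i)"
  then obtain x where x: "\<exists>i<n. x i \<noteq> 0" "\<forall>i<n. (\<Sum>j<n. A $$ (i, j) * x j) = z * x i"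
    by blast
  have "vec n x \<noteq> 0\<^sub>v n" using x(1) by (metis index_vec index_zero_vec(1))
  moreover have "A *\<^sub>v vec n x = z \<cdot>\<^sub>v vec n x"
    using assms x(2) by (intro eq_vecI) (auto simp: scalar_prod_def atLeast0LessThan)
  ultimately show "eigenvalue A z"
    using assms by (auto simp: eigenvalue_def eigenvector_def intro!: exI[of _ "vec n x"])
qed

text \<open>Both matrices have the same characteristic polynomial. This gives access to left
  eigenvectors.\<close>

lemma eigenvalue_transpose_iff:
  fixes A :: "'a :: field mat"
  assumes "A \<in> carrier_mat n n"
  shows "eigenvalue (transpose_mat A) z \<longleftrightarrow> eigenvalue A z"
  using assms eigenvalue_root_char_poly[of A n z] eigenvalue_root_char_poly[of "transpose_mat A" n z]
  by simp

definition complement_laplacian :: "nat \<Rightarrow> real mat \<Rightarrow> real mat" where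
  "complement_laplacian n L = mat n n (\<lambda>(i, j). of_bool (i = j) - 1 / real n - L $$ (i, j))"

text \<open>Off the diagonal, \<open>t \<mapsto> - 1 / n - t\<close> reverses the interval
  \<open>[- 1 / n, 0]\<close>; the row sums of \<open>I\<close> and \<open>J / n\<close> are both 1
  and cancel.\<close>

lemma standardized_laplacian_complement:
  assumes "n > 0" "standardized_laplacian n L"
  shows "standardized_laplacian n (complement_laplacian n L)"
  using assms
  by (auto simp: standardized_laplacian_def complement_laplacian_def sum_subtractf of_bool_def)

text \<open>
  A left eigenvector for an eigenvalue \<open>z \<noteq> 0\<close> is orthogonal to the all-ones vector, so the
  all-ones matrix annihilates it.
\<close>
lemma eigenvalue_complement:
  assumes L: "standardized_laplacian n L" and ev: "eigenvalue (map_mat complex_of_real L) z"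
    and "z \<noteq> 0"
  shows "eigenvalue (map_mat complex_of_real (complement_laplacian n L)) (1 - z)"
proof -
  have carrier: "map_mat complex_of_real L \<in> carrier_mat n n"
    "map_mat complex_of_real (complement_laplacian n L) \<in> carrier_mat n n"
    using L by (auto simp: standardized_laplacian_def complement_laplacian_def)
  have dims: "dim_row L = n" "dim_col L = n" using carrier(1) by auto
  obtain y where nz: "\<exists>i<n. y i \<noteq> 0"
    and y: "\<And>i. i < n \<Longrightarrow> (\<Sum>j<n. of_real (L $$ (j, i)) * y j) = z * y i"
    using ev eigenvalue_transpose_iff[OF carrier(1)]
      eigenvalue_iff_fun[of "transpose_mat (map_mat complex_of_real L)" n z] carrier(1)
    by (auto simp: dims)
  have "z * (\<Sum>i<n. y i) = (\<Sum>i<n. \<Sum>j<n. of_real (L $$ (j, i)) * y j)"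
    using y by (simp add: sum_distrib_left)
  also have "\<dots> = (\<Sum>j<n. \<Sum>i<n. of_real (L $$ (j, i)) * y j)"
    by (rule sum.swap)
  also have "\<dots> = (\<Sum>j<n. of_real (\<Sum>i<n. L $$ (j, i)) * y j)"
    by (simp add: sum_distrib_right)
  also have "\<dots> = 0"
    using L by (simp add: standardized_laplacian_def del: of_real_sum)
  finally have sum0: "(\<Sum>i<n. y i) = 0" using \<open>z \<noteq> 0\<close> by simp
  have "(\<Sum>j<n. of_real (complement_laplacian n L $$ (j, i)) * y j) = (1 - z) * y i"
    if "i < n" for i
  proof -
    have "(\<Sum>j<n. of_real (complement_laplacian n L $$ (j, i)) * y j) =
        (\<Sum>j<n. (if j = i then y j else 0) - 1 / of_nat n * y j - of_real (L $$ (j, i)) * y j)"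
      using that by (intro sum.cong) (auto simp: complement_laplacian_def algebra_simps)
    also have "\<dots> = y i - 1 / of_nat n * (\<Sum>j<n. y j) - (\<Sum>j<n. of_real (L $$ (j, i)) * y j)"
      using that by (simp add: sum_subtractf sum_distrib_left)
    finally show ?thesis using y[OF that] sum0 by (simp add: algebra_simps)
  qed
  then have "eigenvalue (transpose_mat (map_mat complex_of_real (complement_laplacian n L))) (1 - z)"
    using nz carrier(2)
    by (subst eigenvalue_iff_fun[of _ n]) (auto simp: complement_laplacian_def intro!: exI[of _ y])
  then show ?thesis using eigenvalue_transpose_iff[OF carrier(2)] by blast
qed

text \<open>A form of the argument bound that also makes sense at \<open>z = 0\<close>: it says
  \<open>cos (\<bar>Arg z\<bar> + pi / n) \<ge> 0\<close> multiplied by \<open>cmod z\<close>. As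
  \<open>a\<close> is real, conjugation reduces the lower half-plane to the upper one.\<close>

lemma laplacian_eigenvalue_in_sector:
  fixes a :: "nat \<Rightarrow> nat \<Rightarrow> real" and x :: "nat \<Rightarrow> complex"
  assumes "n \<ge> 2"
    and nonpos: "\<And>i j. i < n \<Longrightarrow> j < n \<Longrightarrow> j \<noteq> i \<Longrightarrow> a i j \<le> 0"
    and row_sum: "\<And>i. i < n \<Longrightarrow> (\<Sum>j<n. a i j) = 0"
    and eig: "\<And>i. i < n \<Longrightarrow> (\<Sum>j<n. of_real (a i j) * x j) = z * x i"
    and nz: "\<exists>i<n. x i \<noteq> 0"
  shows "\<bar>Im z\<bar> * sin (pi / real n) \<le> Re z * cos (pi / real n)"
proof -
  obtain i where "cmod (z - of_real (a i i)) \<le> a i i"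
    using gershgorin_laplacian[of n a x z] assms by blast
  then have "Re z \<ge> 0"
    using abs_Re_le_cmod[of "z - of_real (a i i)"] by simp
  have upper: "Im w * sin (pi / real n) \<le> Re w * cos (pi / real n)"
    if "Im w > 0" "Re w \<ge> 0" "Arg w \<le> pi / 2 - pi / real n" for w
  proof -
    have "Arg w > 0" using \<open>Im w > 0\<close> Arg_lt_pi by blast
    have "pi / real n > 0" using assms by simp
    have "cos (Arg w + pi / real n) \<ge> 0"
      using that \<open>Arg w > 0\<close> \<open>pi / real n > 0\<close> by (intro cos_ge_zero) linarith+
    then have "cmod w * cos (Arg w + pi / real n) \<ge> 0" by simp
    moreover have "Re w = cmod w * cos (Arg w)" "Im w = cmod w * sin (Arg w)"
      using rcis_cmod_Arg[of w] by (metis Re_rcis, metis Im_rcis)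
    ultimately show ?thesis by (simp add: cos_add algebra_simps)
  qed
  show ?thesis
  proof (cases "Im z" "0 :: real" rule: linorder_cases)
    case equal
    have "pi / real n \<le> pi / 2" using \<open>n \<ge> 2\<close> by (intro frac_le) auto
    moreover have "pi / real n \<ge> 0" by simp
    ultimately have "cos (pi / real n) \<ge> 0" by (intro cos_ge_zero) linarith+
    then show ?thesis using equal \<open>Re z \<ge> 0\<close> by simp
  next
    case greater
    then show ?thesis
      using upper[of z] laplacian_eigenvalue_Arg_le[OF nonpos row_sum eig nz] \<open>Re z \<ge> 0\<close> by simp
  next
    case less
    have "(\<Sum>j<n. of_real (a i j) * cnj (x j)) = cnj z * cnj (x i)" if "i < n" for i
      using arg_cong[OF eig[OF that], of cnj] by simp
    then have "Arg (cnj z) \<le> pi / 2 - pi / real n"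
      using laplacian_eigenvalue_Arg_le[of n a "\<lambda>j. cnj (x j)" "cnj z"]
        nz less \<open>Re z \<ge> 0\<close> nonpos row_sum by simp
    then show ?thesis using upper[of "cnj z"] less \<open>Re z \<ge> 0\<close> by simp
  qed
qed

section \<open>From inequalities to closed angles\<close>

lemma sector_eq_cone:
  assumes "0 < \<phi>" "\<phi> \<le> pi / 2" "\<bar>Im z\<bar> * sin \<phi> \<le> Re z * cos \<phi>" "Re z \<ge> 0"
  obtains s t where "s \<ge> 0" "t \<ge> 0"
    "z = of_real s * cis (- (pi / 2 - \<phi>)) + of_real t * cis (pi / 2 - \<phi>)"
\<comment> \<open>For \<open>\<phi> = pi / 2\<close>, the case \<open>n = 2\<close>, both rays
  coincide with the nonnegative real axis. The inequality then forces \<open>Im z = 0\<close>, and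
  the sign of \<open>Re z\<close> comes from the last assumption.\<close>
proof (cases "\<phi> = pi / 2")
  case True
  then have "sin \<phi> = 1" "cos \<phi> = 0" by (simp_all only: sin_pi_half cos_pi_half)
  then have "z = of_real (Re z)" using assms(3) by (simp add: complex_eq_iff)
  then show ?thesis using that[of "Re z" 0] True assms(4) by simp
next
  case False
  then have pos: "cos \<phi> > 0" "sin \<phi> > 0"
    using assms by (auto intro!: cos_gt_zero sin_gt_zero)
  \<comment> \<open>The rays have directions \<open>(sin \<phi>, - cos \<phi>)\<close> and
    \<open>(sin \<phi>, cos \<phi>)\<close>; \<open>s\<close> and \<open>t\<close> solve the
    resulting linear system.\<close>
  define s where "s = (Re z / sin \<phi> - Im z / cos \<phi>) / 2"
  define t where "t = (Re z / sin \<phi> + Im z / cos \<phi>) / 2"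
  have "\<bar>Im z\<bar> / cos \<phi> \<le> Re z / sin \<phi>"
    using assms(3) pos by (simp add: field_simps)
  moreover have "\<bar>Im z / cos \<phi>\<bar> = \<bar>Im z\<bar> / cos \<phi>" using pos by simp
  ultimately have "\<bar>Im z / cos \<phi>\<bar> \<le> Re z / sin \<phi>" by (simp only:)
  then have "Im z / cos \<phi> \<le> Re z / sin \<phi>" "- (Im z / cos \<phi>) \<le> Re z / sin \<phi>"
    by (simp_all only: abs_le_iff)
  then have "s \<ge> 0" "t \<ge> 0" by (simp_all add: s_def t_def)
  moreover have "z = of_real s * cis (- (pi / 2 - \<phi>)) + of_real t * cis (pi / 2 - \<phi>)"
  proof -
    have "cis (- (pi / 2 - \<phi>)) = Complex (sin \<phi>) (- cos \<phi>)"
      "cis (pi / 2 - \<phi>) = Complex (sin \<phi>) (cos \<phi>)"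
      by (simp_all add: complex_eq_iff cos_diff sin_diff)
    then show ?thesis using pos by (simp add: complex_eq_iff s_def t_def field_simps)
  qed
  ultimately show ?thesis by (rule that)
qed

lemma cone_in_closed_smaller_angle:
  assumes "s \<ge> 0" "t \<ge> 0"
  shows "v + of_real s * (p - v) + of_real t * (q - v) \<in> closed_smaller_angle v p q"
proof -
  \<comment> \<open>Doubling the parameters makes the target the midpoint of two points on the
    half-lines.\<close>
  define p' where "p' = v + complex_of_real (2 * s) * (p - v)"
  define q' where "q' = v + complex_of_real (2 * t) * (q - v)"
  have "p' \<in> half_line v p" "q' \<in> half_line v q"
    using assms by (auto simp: half_line_def p'_def q'_def intro: exI[of _ "2 * s"] exI[of _ "2 * t"])
  then have "(1 / 2) *\<^sub>R p' + (1 / 2) *\<^sub>R q' \<in> convex hull (half_line v p \<union> half_line v q)"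
    by (intro convexD[OF convex_convex_hull] hull_inc) auto
  also have "(1 / 2) *\<^sub>R p' + (1 / 2) *\<^sub>R q' = v + of_real s * (p - v) + of_real t * (q - v)"
    by (simp add: p'_def q'_def scaleR_conv_of_real field_simps)
  finally show ?thesis by (simp add: closed_smaller_angle_def)
qed

text \<open>The chord from \<open>cis (2 * \<phi>)\<close> to 1 is parallel to a boundary ray of the
  angle at 0; hence \<open>z \<mapsto> 1 - z\<close> exchanges the two angles.\<close>

lemma one_minus_cis: "1 - cis (2 * \<phi>) = of_real (2 * sin \<phi>) * cis (\<phi> - pi / 2)"
  by (simp add: complex_eq_iff cos_double_sin sin_double cos_diff sin_diff power2_eq_square)

text \<open>The bounds proved directly; they are applied both to \<open>L\<close> and to its
  complement.\<close>

lemma standardized_laplacian_eigenvalue_bounds: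
  assumes "n \<ge> 2" and L: "standardized_laplacian n L"
    and ev: "eigenvalue (map_mat complex_of_real L) z"
  shows "z \<in> cball (of_real (1 - 1 / real n)) (1 - 1 / real n)"
    and "\<bar>Im z\<bar> * sin (pi / real n) \<le> Re z * cos (pi / real n)"
    and "\<bar>Im z\<bar> \<le> 1 / (2 * real n) * cot (pi / (2 * real n))"
    and "Re z \<ge> 0"
proof -
  have carrier: "map_mat complex_of_real L \<in> carrier_mat n n"
    using L by (auto simp: standardized_laplacian_def)
  have dims: "dim_row L = n" "dim_col L = n" using carrier by auto
  obtain x where nz: "\<exists>i<n. x i \<noteq> 0"
    and eig: "\<And>i. i < n \<Longrightarrow> (\<Sum>j<n. of_real (L $$ (i, j)) * x j) = z * x i"
    using ev eigenvalue_iff_fun[OF carrier] by (auto simp: dims)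
  have entries: "- (1 / real n) \<le> L $$ (i, j)" "L $$ (i, j) \<le> 0" if "i < n" "j < n" "j \<noteq> i" for i j
    using L that by (auto simp: standardized_laplacian_def)
  have row_sum: "(\<Sum>j<n. L $$ (i, j)) = 0" if "i < n" for i
    using L that by (auto simp: standardized_laplacian_def)
  obtain i where i: "i < n" "cmod (z - of_real (L $$ (i, i))) \<le> L $$ (i, i)"
    using gershgorin_laplacian[OF entries(2) row_sum eig nz] by blast
  let ?c = "1 - 1 / real n"
  \<comment> \<open>Moving the centre right to \<open>?c\<close> costs exactly the increase of the
    radius from \<open>L $$ (i, i)\<close> to \<open>?c\<close>.\<close>
  have "cmod (z - of_real ?c) \<le> cmod (z - of_real (L $$ (i, i))) + cmod (of_real (L $$ (i, i) - ?c))"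
    using norm_triangle_ineq[of "z - of_real (L $$ (i, i))" "of_real (L $$ (i, i) - ?c)"]
    by (simp add: algebra_simps)
  also have "\<dots> \<le> ?c"
    using i(2) standardized_laplacian_diag_le[OF L i(1)] by (simp del: of_real_diff)
  finally show "z \<in> cball (of_real ?c) ?c" by (simp add: dist_norm norm_minus_commute)
  show "Re z \<ge> 0"
    using i(2) abs_Re_le_cmod[of "z - of_real (L $$ (i, i))"] by simp
  show "\<bar>Im z\<bar> * sin (pi / real n) \<le> Re z * cos (pi / real n)"
    by (rule laplacian_eigenvalue_in_sector[OF \<open>n \<ge> 2\<close> entries(2) row_sum eig nz])
  have skew: "\<bar>L $$ (i, j) - L $$ (j, i)\<bar> \<le> 2 * (1 / (2 * real n))" if "i < n" "j < n" for i j
    using entries[of i j] entries[of j i] that by (cases "i = j") (auto simp: abs_le_iff)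
  show "\<bar>Im z\<bar> \<le> 1 / (2 * real n) * cot (pi / (2 * real n))"
    by (rule abs_Im_eigenvalue_le[OF skew eig nz])
qed

theorem theorem5:
  fixes n :: nat and L :: "real mat" and z :: complex
  assumes "n \<ge> 2"
    and "standardized_laplacian n L"
    and "eigenvalue (map_mat complex_of_real L) z"
  shows "z \<in> cball (complex_of_real (1 / real n)) (1 - 1 / real n)
           \<inter> cball (complex_of_real (1 - 1 / real n)) (1 - 1 / real n)
           \<inter> closed_smaller_angle 1 (cis (- (2 * pi / real n))) (cis (2 * pi / real n))
           \<inter> closed_smaller_angle 0 (cis (- (pi / 2 - pi / real n))) (cis (pi / 2 - pi / real n))
           \<inter> {w. \<bar>Im w\<bar> \<le> 1 / (2 * real n) * cot (pi / (2 * real n))}"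
proof -
  define \<phi> where "\<phi> = pi / real n"
  have \<phi>: "0 < \<phi>" "\<phi> \<le> pi / 2"
    unfolding \<phi>_def using \<open>n \<ge> 2\<close> by (simp, intro frac_le) auto
  then have "sin \<phi> > 0" "cos \<phi> \<ge> 0" by (auto intro!: sin_gt_zero cos_ge_zero)
  note bounds = standardized_laplacian_eigenvalue_bounds[OF assms(1), folded \<phi>_def]
  have co: "1 - z \<in> cball (of_real (1 - 1 / real n)) (1 - 1 / real n) \<and>
      \<bar>Im (1 - z)\<bar> * sin \<phi> \<le> Re (1 - z) * cos \<phi> \<and> Re (1 - z) \<ge> 0"
  proof (cases "z = 0")
    \<comment> \<open>The transfer to the complement excludes \<open>z = 0\<close>, so the point 1
      is checked directly; \<open>n \<ge> 2\<close> puts it in the disk.\<close>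
    case True
    have "1 / real n \<le> 1 - 1 / real n" using \<open>n \<ge> 2\<close> by (simp add: field_simps)
    then show ?thesis using True \<open>cos \<phi> \<ge> 0\<close> by (simp add: dist_norm norm_divide)
  next
    case False
    have "standardized_laplacian n (complement_laplacian n L)"
      using assms by (intro standardized_laplacian_complement) auto
    then show ?thesis
      using bounds eigenvalue_complement[OF assms(2,3) False] by blast
  qed
  have "z \<in> cball (of_real (1 / real n)) (1 - 1 / real n)"
  proof -
    have "of_real (1 - 1 / real n) - (1 - z) = z - complex_of_real (1 / real n)" by simp
    then show ?thesis using co by (simp only: mem_cball dist_norm norm_minus_commute)
  qed
  moreover have "z \<in> closed_smaller_angle 0 (cis (- (pi / 2 - \<phi>))) (cis (pi / 2 - \<phi>))"
  proof -
    obtain s t where "s \<ge> 0" "t \<ge> 0"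
      "z = of_real s * cis (- (pi / 2 - \<phi>)) + of_real t * cis (pi / 2 - \<phi>)"
      using sector_eq_cone[OF \<phi> bounds(2,4)[OF assms(2,3)]] by metis
    then show ?thesis
      using cone_in_closed_smaller_angle[of s t 0 "cis (- (pi / 2 - \<phi>))" "cis (pi / 2 - \<phi>)"] by simp
  qed
  moreover have "z \<in> closed_smaller_angle 1 (cis (- (2 * \<phi>))) (cis (2 * \<phi>))"
  proof -
    from co have "\<bar>Im (1 - z)\<bar> * sin \<phi> \<le> Re (1 - z) * cos \<phi>" "Re (1 - z) \<ge> 0" by blast+
    from sector_eq_cone[OF \<phi> this] obtain s t where st: "s \<ge> 0" "t \<ge> 0"
      "1 - z = of_real s * cis (- (pi / 2 - \<phi>)) + of_real t * cis (pi / 2 - \<phi>)" by metis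
    \<comment> \<open>The chord \<open>1 - cis (2 * \<phi>)\<close> has length
      \<open>2 * sin \<phi>\<close>, so \<open>r\<close> normalises it. Reflection exchanges the
      upper and lower rays, hence the crossed coefficients \<open>t\<close> and \<open>s\<close>
      below.\<close>
    define r where "r = 1 / (2 * sin \<phi>)"
    have "r \<ge> 0" using \<open>sin \<phi> > 0\<close> by (simp add: r_def)
    have dirs: "cis (- (pi / 2 - \<phi>)) = of_real r * (1 - cis (2 * \<phi>))"
      "cis (pi / 2 - \<phi>) = of_real r * (1 - cis (- (2 * \<phi>)))"
      using \<open>sin \<phi> > 0\<close> one_minus_cis[of \<phi>] one_minus_cis[of "- \<phi>"]
      by (simp_all add: r_def complex_eq_iff cos_diff sin_diff)
    have "z = 1 + of_real (t * r) * (cis (- (2 * \<phi>)) - 1) + of_real (s * r) * (cis (2 * \<phi>) - 1)"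
      using st(3) unfolding dirs by (simp add: algebra_simps)
    then show ?thesis
      using cone_in_closed_smaller_angle[of "t * r" "s * r"] st \<open>r \<ge> 0\<close> by simp
  qed
  ultimately show ?thesis
    using bounds(1,3)[OF assms(2,3)] by (simp add: \<phi>_def)
qed

end
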